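(* Let $A,B\in\mathbb{C}^{n\times n}$ with $A^{\mathsf H}=A$, $B^{\mathsf T}=B$, and $H=\begin{bmatrix}A&B\\-\overline{B}&-\overline{A}\end{bmatrix}$. Let $k_0>1$ be an integer, $\vartheta\in\{-1,1\}$, $\alpha>0$, $\beta\in\mathbb{R}$ with $\vartheta\beta>0$, $\kappa>1$, and $\gamma=\beta\,\dfrac{\kappa^{2^{k_0}}+\vartheta}{\vartheta\kappa^{2^{k_0}}-1}$. Let $\lambda<0$ be a (real, negative) eigenvalue of $H$, and put $$\delta_\lambda=\frac{\lambda+\alpha}{\lambda-\alpha},\qquad \varpi=\frac{\beta-\vartheta\gamma}{\beta\vartheta+\gamma},\qquad \nu=\vartheta\cdot\frac{\varpi+\delta_\lambda^{2^{k_0}}}{1+\varpi\,\delta_\lambda^{2^{k_0}}}.$$ Then $$|\nu|\le\max\left\{|\delta_\lambda|^{2^{k_0}},\ \kappa^{-2^{k_0}}\right\}.$$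
   Context: Here $\nu$ is the eigenvalue of the new symplectic pair produced by a double-Cayley transform (with parameters $\vartheta,\beta,\gamma$) at step $k_0$ of the doubling algorithm that corresponds to the eigenvalue $\lambda$ of $H$; $\delta_\lambda^{2^{k_0}}$ is the corresponding eigenvalue before the transform. *)

theory Defs
  imports "Jordan_Normal_Form.Schur_Decomposition" Complex_Main
begin

definition block_hamiltonian :: "complex mat \<Rightarrow> complex mat \<Rightarrow> complex mat" where
  "block_hamiltonian A B = four_block_mat A B (- map_mat cnj B) (- map_mat cnj A)"

end

theory Submission
  imports Defs
begin

text \<open>
  The choice of \<open>\<gamma>\<close> is made so that, for either sign \<open>\<theta>\<close>, the transform parameter is
  \<open>varpi = - inverse K\<close> with \<open>K = \<kappa> ^ (2 ^ k\<^sub>0)\<close>. Writing \<open>w = inverse K\<close> and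
  \<open>d = \<delta> ^ (2 ^ k\<^sub>0)\<close>, the new eigenvalue is therefore, up to sign, \<open>(d - w) / (1 - w * d)\<close>.
  Both \<open>w\<close> and \<open>d\<close> lie in \<open>[0, 1)\<close>: the first because \<open>\<kappa> > 1\<close>, the second because the Cayley
  transform sends negative reals into the open interval \<open>(-1, 1)\<close> and the exponent is even. The
  absolute value of the quotient is the pseudo-hyperbolic distance of \<open>d\<close> and \<open>w\<close>, which on
  \<open>[0, 1)\<close> never exceeds the larger of the two points.
\<close>

text \<open>
  If \<open>w \<le> d\<close>, say, then \<open>d - w \<le> d - w * d\<^sup>2 = d * (1 - w * d)\<close>, as \<open>d \<le> 1\<close>; the other case is
  symmetric.
\<close>

lemma pseudo_hyperbolic_dist_le_max:
  fixes d w :: real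
  assumes "0 \<le> d" "d < 1" "0 \<le> w" "w < 1"
  shows "\<bar>(d - w) / (1 - w * d)\<bar> \<le> max d w"
proof -
  have wlog: "\<bar>(x - y) / (1 - y * x)\<bar> \<le> x" if "0 \<le> y" "y \<le> x" "x < 1" for x y :: real
  proof -
    have "y * x < 1"
      using that mult_left_le[of x y] by linarith
    moreover have "x * x \<le> 1"
      using that mult_le_one[of x x] by simp
    then have "y * (x * x) \<le> y"
      using that by (simp add: mult_left_le)
    ultimately show ?thesis
      using that by (simp add: abs_div_pos divide_simps algebra_simps)
  qed
  show ?thesis
  proof (cases "w \<le> d")
    case True
    then show ?thesis
      using wlog[of w d] assms by simp
  next
    case False
    then show ?thesis
      using wlog[of d w] assms by (simp add: abs_minus_commute mult.commute)
  qed
qed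

lemma abs_cayley_less_one:
  fixes l \<alpha> :: real
  assumes "l < 0" "\<alpha> > 0"
  shows "\<bar>(l + \<alpha>) / (l - \<alpha>)\<bar> < 1"
proof -
  have "\<bar>l + \<alpha>\<bar> < \<bar>l - \<alpha>\<bar>"
    using assms by linarith
  then show ?thesis
    by simp
qed

text \<open>
  The formula for \<open>\<gamma>\<close> is the solution of \<open>varpi = - inverse K\<close> for \<open>\<gamma>\<close>. After clearing the
  denominator \<open>\<theta> * K - 1\<close>, the identity \<open>\<theta>\<^sup>2 = 1\<close> reduces the numerator and the
  denominator of the quotient to \<open>- 2 * \<beta>\<close> and \<open>2 * \<beta> * K\<close>.
\<close>

lemma double_cayley_parameter_eq:
  fixes \<theta> \<beta> \<gamma> K :: real
  assumes "\<theta> \<in> {-1, 1}" "\<beta> \<noteq> 0" "K > 1"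
    and \<gamma>: "\<gamma> = \<beta> * ((K + \<theta>) / (\<theta> * K - 1))"
  shows "(\<beta> - \<theta> * \<gamma>) / (\<beta> * \<theta> + \<gamma>) = - inverse K"
proof -
  have nz: "\<theta> * K - 1 \<noteq> 0" and sq: "\<theta> * \<theta> = 1"
    using assms(1,3) by auto
  have clear: "\<gamma> * (\<theta> * K - 1) = \<beta> * (K + \<theta>)"
    using nz \<gamma> by simp
  have num: "(\<beta> - \<theta> * \<gamma>) * (\<theta> * K - 1) = - 2 * \<beta>"
  proof -
    have "(\<beta> - \<theta> * \<gamma>) * (\<theta> * K - 1)
        = \<beta> * (\<theta> * K - 1) - \<theta> * (\<gamma> * (\<theta> * K - 1))"
      by (simp add: algebra_simps)
    also have "\<dots> = - \<beta> - (\<theta> * \<theta>) * \<beta>"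
      unfolding clear by (simp add: algebra_simps)
    finally show ?thesis
      by (simp add: sq)
  qed
  have den: "(\<beta> * \<theta> + \<gamma>) * (\<theta> * K - 1) = 2 * \<beta> * K"
  proof -
    have "(\<beta> * \<theta> + \<gamma>) * (\<theta> * K - 1)
        = \<beta> * \<theta> * (\<theta> * K - 1) + \<gamma> * (\<theta> * K - 1)"
      by (simp add: algebra_simps)
    also have "\<dots> = (\<theta> * \<theta>) * \<beta> * K + \<beta> * K"
      unfolding clear by (simp add: algebra_simps)
    finally show ?thesis
      by (simp add: sq)
  qed
  have "(\<beta> - \<theta> * \<gamma>) / (\<beta> * \<theta> + \<gamma>)
      = ((\<beta> - \<theta> * \<gamma>) * (\<theta> * K - 1)) / ((\<beta> * \<theta> + \<gamma>) * (\<theta> * K - 1))"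
    using nz by simp
  also have "\<dots> = (- 2 * \<beta>) / (2 * \<beta> * K)"
    unfolding num den ..
  also have "\<dots> = - inverse K"
    using assms(2) by (simp add: field_simps)
  finally show ?thesis .
qed

theorem corollary3p14:
  fixes A B :: "complex mat" and n k\<^sub>0 :: nat
    and \<theta> \<alpha> \<beta> \<gamma> \<kappa> l \<delta> varpi \<nu> :: real
  assumes "A \<in> carrier_mat n n" and "B \<in> carrier_mat n n"
    and "mat_adjoint A = A" and "transpose_mat B = B"
    and "k\<^sub>0 > 1" and "\<theta> \<in> {-1, 1}" and "\<alpha> > 0" and "\<theta> * \<beta> > 0" and "\<kappa> > 1"
    and "\<gamma> = \<beta> * ((\<kappa> ^ (2 ^ k\<^sub>0) + \<theta>) / (\<theta> * \<kappa> ^ (2 ^ k\<^sub>0) - 1))"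
    and "eigenvalue (block_hamiltonian A B) (complex_of_real l)" and "l < 0"
    and "\<delta> = (l + \<alpha>) / (l - \<alpha>)"
    and "varpi = (\<beta> - \<theta> * \<gamma>) / (\<beta> * \<theta> + \<gamma>)"
    and "\<nu> = \<theta> * ((varpi + \<delta> ^ (2 ^ k\<^sub>0)) / (1 + varpi * \<delta> ^ (2 ^ k\<^sub>0)))"
  shows "\<bar>\<nu>\<bar> \<le> max (\<bar>\<delta>\<bar> ^ (2 ^ k\<^sub>0)) (\<kappa> powi (- (2 ^ k\<^sub>0)))"
proof -
  define d where "d = \<delta> ^ (2 ^ k\<^sub>0)"
  define K where "K = \<kappa> ^ (2 ^ k\<^sub>0)"
  have K: "K > 1"
    unfolding K_def using \<open>\<kappa> > 1\<close> by (simp add: one_less_power)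
  have "\<bar>\<delta>\<bar> < 1"
    using abs_cayley_less_one \<open>l < 0\<close> \<open>\<alpha> > 0\<close> \<open>\<delta> = _\<close> by simp
  \<comment> \<open>Evenness of the exponent makes \<open>d\<close> nonnegative.\<close>
  moreover have d_abs: "d = \<bar>\<delta>\<bar> ^ (2 ^ k\<^sub>0)"
    unfolding d_def using \<open>k\<^sub>0 > 1\<close> by (simp add: power_even_abs)
  ultimately have d: "0 \<le> d" "d < 1"
    by (simp_all add: power_less_one_iff)
  have "\<beta> \<noteq> 0"
    using \<open>\<theta> * \<beta> > 0\<close> by auto
  then have varpi: "varpi = - inverse K"
    using double_cayley_parameter_eq[of \<theta> \<beta> K \<gamma>] assms(6,10,14) K by (simp add: K_def)
  have "\<bar>\<theta>\<bar> = 1"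
    using \<open>\<theta> \<in> {-1, 1}\<close> by auto
  then have "\<bar>\<nu>\<bar> = \<bar>(d - inverse K) / (1 - inverse K * d)\<bar>"
    unfolding assms(15) abs_mult d_def[symmetric] varpi by simp
  also have "\<dots> \<le> max d (inverse K)"
    using d K by (intro pseudo_hyperbolic_dist_le_max) (simp_all add: inverse_less_1_iff)
  also have "inverse K = \<kappa> powi (- (2 ^ k\<^sub>0))"
    using power_int_of_nat[of \<kappa> "2 ^ k\<^sub>0"] by (simp add: K_def power_int_minus)
  finally show ?thesis
    by (simp only: d_abs)
qed

end
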